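(* Let $a > 0$, $\lambda > 0$, let $\mathfrak{u}$ be uniformly distributed on $(0,a)$, let $\mathfrak{e}$ be exponentially distributed with mean $\frac{1}{\lambda}$, and let $\mathfrak{u}$ and $\mathfrak{e}$ be independent random variables. Denote $\xi := \min(\mathfrak{u}, \mathfrak{e})$. Then: (a) $\xi \in \text{Min-U-Exp}(a; \lambda)$. (b) The mean of $\xi$ is $\mathbb{E}\xi = \frac{1}{a \lambda^2}\left(a\lambda - 1 + e^{-\lambda a}\right)$, and its moments are $$\mathbb{E}(\xi^k) = \frac{k}{\lambda^k}\left(\gamma(k, a\lambda) - \frac{\gamma(k+1, a\lambda)}{a\lambda}\right), \quad k \in \mathbb{N}.$$ (c) The variance of $\xi$ is $$\mathbb{D}\xi = \frac{1}{\lambda^2}\left(2 + 2e^{-\lambda a}-\frac{1}{a^2\lambda^2}\left(a\lambda+1-e^{-\lambda a}\right)^2\right).$$ (d) The Laplace-Stieltjes transform of $\xi$ is $$\mathbb{E}(e^{-\xi t}) = \frac{\lambda}{\lambda + t} + \frac{t}{a(\lambda + t)^2}\left(1 - e^{-(\lambda + t) a}\right), \quad t \geq 0.$$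
   Context: A random variable $\xi$ is Min-U-Exp distributed with parameters $a>0$ and $\lambda>0$, written $\xi \in \text{Min-U-Exp}(a;\lambda)$, if its cumulative distribution function is $$F_\xi(x) = \begin{cases} 0, & x \leq 0,\\ 1-e^{-\lambda x} + \frac{x}{a}e^{-\lambda x}, & x \in (0, a],\\ 1, & x > a.\end{cases}$$ $\gamma(s,x) = \int_0^x u^{s-1}e^{-u}\,du$ is the lower incomplete gamma function. $\mathbb{D}$ denotes the variance, and $\mathbb{N} = \{1,2,\ldots\}$. *)

theory Defs
  imports "HOL-Probability.Probability"
begin

(* Only used for s > 0 and x \<ge> 0.  The value 0 powr (s - 1) = 0 at the endpoint u = 0
   does not affect the integral. *)
definition lower_incomplete_gamma :: "real \<Rightarrow> real \<Rightarrow> real" where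
  "lower_incomplete_gamma s x = integral {0..x} (\<lambda>u. u powr (s - 1) * exp (- u))"

definition min_U_Exp_cdf :: "real \<Rightarrow> real \<Rightarrow> real \<Rightarrow> real" where
  "min_U_Exp_cdf a l x =
     (if x \<le> 0 then 0
      else if x \<le> a then 1 - exp (- l * x) + x / a * exp (- l * x)
      else 1)"

definition min_U_Exp_distributed :: "'a measure \<Rightarrow> ('a \<Rightarrow> real) \<Rightarrow> real \<Rightarrow> real \<Rightarrow> bool" where
  "min_U_Exp_distributed M X a l \<longleftrightarrow>
     a > 0 \<and> l > 0 \<and> X \<in> borel_measurable M \<and>
     (\<forall>x. cdf (distr M borel X) x = min_U_Exp_cdf a l x)"

end

theory Submission
  imports Defs
begin

text \<open>
  By independence, the tail of the minimum is \<open>(1 - x/a) exp (-l x)\<close> on \<open>[0, a]\<close>, whence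
  the distribution function. Differentiating gives the density
  \<open>(l + 1/a - l x/a) exp (-l x)\<close>, and all expectations are then evaluated by exhibiting an
  antiderivative: integration by parts against the tail produces the incomplete gamma functions
  in the moments, and an affine function times \<open>exp (-(l+t) x)\<close> handles the Laplace transform.
\<close>

section \<open>The incomplete gamma function at positive integers\<close>

lemma lower_incomplete_gamma_Suc:
  "lower_incomplete_gamma (real (Suc n)) x = integral {0..x} (\<lambda>u. u ^ n * exp (- u))"
  unfolding lower_incomplete_gamma_def
\<comment> \<open>The integrands can differ only at u = 0, and do so for n = 0:
  \<open>0 powr 0 = 0\<close> while \<open>0 ^ 0 = 1\<close>.\<close>
proof (rule integral_spike[of "{0}"])
  fix u assume "u \<in> {0..x} - {0}"
  then show "u ^ n * exp (- u) = u powr (real (Suc n) - 1) * exp (- u)"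
    by (simp add: powr_realpow)
qed simp

lemma lower_incomplete_gamma_0_right: "lower_incomplete_gamma s 0 = 0"
  by (simp add: lower_incomplete_gamma_def)

text \<open>The integrand with natural powers is continuous on the whole interval, so the
  fundamental theorem of calculus applies. The derivative is relative to \<open>{0..b}\<close>
  because the function vanishes for negative arguments, which for n = 0 leaves only a one-sided
  derivative at 0.\<close>

lemma has_real_derivative_lower_incomplete_gamma_Suc:
  assumes "t \<in> {0..b}"
  shows "(lower_incomplete_gamma (real (Suc n)) has_real_derivative t ^ n * exp (- t))
           (at t within {0..b})"
proof -
  have "((\<lambda>x. integral {0..x} (\<lambda>u. u ^ n * exp (- u))) has_real_derivative t ^ n * exp (- t))
          (at t within {0..b})"
    using assms by (intro integral_has_real_derivative continuous_intros)
  then show ?thesis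
    by (simp only: lower_incomplete_gamma_Suc[abs_def])
qed

lemma has_real_derivative_lower_incomplete_gamma_scaled:
  assumes "0 < l" "x \<in> {0..a}"
  shows "((\<lambda>x. lower_incomplete_gamma (real (Suc n)) (l * x)) has_real_derivative
           l * ((l * x) ^ n * exp (- (l * x)))) (at x within {0..a})"
proof -
  have 1: "(lower_incomplete_gamma (real (Suc n)) has_real_derivative (l * x) ^ n * exp (- (l * x)))
          (at (l * x) within (*) l ` {0..a})"
    using assms
    by (intro DERIV_subset[OF has_real_derivative_lower_incomplete_gamma_Suc[where b="l * a"]]) auto
  have 2: "((*) l has_real_derivative l) (at x within {0..a})"
    by (auto intro!: derivative_eq_intros)
  show ?thesis
    using DERIV_image_chain[OF 1 2] by (simp add: o_def mult.commute del: of_nat_Suc)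
qed

lemma lower_incomplete_gamma_1:
  assumes "0 \<le> x"
  shows "lower_incomplete_gamma 1 x = 1 - exp (- x)"
proof -
  have "((\<lambda>u. u ^ 0 * exp (- u)) has_integral (- exp (- x)) - (- exp (- 0))) {0..x}"
    using assms
    by (intro fundamental_theorem_of_calculus)
       (auto intro!: derivative_eq_intros
             simp flip: has_real_derivative_iff_has_vector_derivative)
  then show ?thesis
    using lower_incomplete_gamma_Suc[of 0 x] by (simp add: integral_unique)
qed

text \<open>Integration by parts, checked by differentiating the right-hand side: the terms in u^n
  cancel and u^(n+1) exp(-u) remains.\<close>

lemma lower_incomplete_gamma_rec:
  assumes "0 \<le> x"
  shows "lower_incomplete_gamma (real (Suc (Suc n))) x =
           real (Suc n) * lower_incomplete_gamma (real (Suc n)) x - x ^ Suc n * exp (- x)"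
proof -
  let ?G = "\<lambda>u. real (Suc n) * lower_incomplete_gamma (real (Suc n)) u - u ^ Suc n * exp (- u)"
  have "(?G has_real_derivative u ^ Suc n * exp (- u)) (at u within {0..x})"
    if "u \<in> {0..x}" for u
    by (rule derivative_eq_intros has_real_derivative_lower_incomplete_gamma_Suc that refl)+
       (simp add: algebra_simps)
  then have "((\<lambda>u. u ^ Suc n * exp (- u)) has_integral ?G x - ?G 0) {0..x}"
    using assms
    by (intro fundamental_theorem_of_calculus)
       (auto simp flip: has_real_derivative_iff_has_vector_derivative)
  then show ?thesis
    using lower_incomplete_gamma_Suc[of "Suc n" x]
    by (simp add: integral_unique lower_incomplete_gamma_0_right del: of_nat_Suc)
qed

section \<open>The density and its integrals over half-lines\<close>

definition min_U_Exp_density :: "real \<Rightarrow> real \<Rightarrow> real \<Rightarrow> real" where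
  "min_U_Exp_density a l x = (l + 1 / a - l * x / a) * exp (- l * x) * indicator {0..a} x"

lemma min_U_Exp_density_nonneg:
  assumes "0 < a" "0 < l"
  shows "0 \<le> min_U_Exp_density a l x"
proof -
  have "l * x / a \<le> l" if "x \<le> a"
    using assms that by (simp add: field_simps)
  then show ?thesis
    using assms
    by (auto simp: min_U_Exp_density_def split: split_indicator
             intro!: mult_nonneg_nonneg add_increasing2[of "1 / a"])
qed

lemma borel_measurable_min_U_Exp_density [measurable]:
  "min_U_Exp_density a l \<in> borel_measurable borel"
  unfolding min_U_Exp_density_def[abs_def] by measurable

lemma nn_integral_min_U_Exp_density:
  assumes "0 < a" "0 < l"
  shows "(\<integral>\<^sup>+x. min_U_Exp_density a l x * indicator {..b} x \<partial>lborel) = ennreal (min_U_Exp_cdf a l b)"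
proof (cases "0 \<le> b")
  case False
  then have "(\<integral>\<^sup>+x. min_U_Exp_density a l x * indicator {..b} x \<partial>lborel) = (\<integral>\<^sup>+x. 0 \<partial>(lborel :: real measure))"
    by (intro nn_integral_cong) (auto simp: min_U_Exp_density_def split: split_indicator)
  with False show ?thesis
    by (simp add: min_U_Exp_cdf_def)
next
  case True
  \<comment> \<open>The support \<open>{0..a}\<close> cuts the half-line \<open>{..b}\<close> down
    to \<open>{0..min a b}\<close>. There \<open>?F\<close>, the middle branch of the distribution
    function, is an antiderivative; \<open>?F 0 = 0\<close> and \<open>?F a = 1\<close> make it
    agree with the outer branches.\<close>
  let ?f = "\<lambda>x. (l + 1 / a - l * x / a) * exp (- l * x)"
  let ?F = "\<lambda>x. 1 - exp (- l * x) + x / a * exp (- l * x)"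
  have "0 \<le> ?f x" if "x \<in> {0..min a b}" for x
    using min_U_Exp_density_nonneg[OF assms, of x] that by (simp add: min_U_Exp_density_def)
  moreover have "DERIV ?F x :> ?f x" for x
    using assms by (auto intro!: derivative_eq_intros simp: field_simps)
  ultimately have "(\<integral>\<^sup>+x. ennreal (?f x) * indicator {0..min a b} x \<partial>lborel) = ?F (min a b) - ?F 0"
    using True assms by (intro nn_integral_FTC_Icc) auto
  also have "(\<integral>\<^sup>+x. ennreal (?f x) * indicator {0..min a b} x \<partial>lborel) =
      (\<integral>\<^sup>+x. min_U_Exp_density a l x * indicator {..b} x \<partial>lborel)"
    by (intro nn_integral_cong) (auto simp: min_U_Exp_density_def split: split_indicator)
  also have "?F (min a b) - ?F 0 = min_U_Exp_cdf a l b"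
    using True assms by (auto simp: min_U_Exp_cdf_def min_def)
  finally show ?thesis .
qed

section \<open>The law of the minimum\<close>

context prob_space
begin

text \<open>The densities for the open and the closed interval agree off the null set {0, a}, so the
  closed-interval formula \<open>uniform_distributed_measure\<close> can be used.\<close>

lemma uniform_open_distributed_gt:
  fixes a :: real
  assumes a: "0 < a"
    and D: "distributed M lborel X (\<lambda>x. ennreal (indicator {0<..<a} x / measure lborel {0<..<a}))"
    and t: "0 \<le> t" "t \<le> a"
  shows "\<P>(x in M. t < X x) = 1 - t / a"
proof -
  have "AE x in lborel. x \<noteq> 0 \<and> x \<noteq> a"
    using AE_lborel_singleton[of 0] AE_lborel_singleton[of a] by eventually_elim simp
  then have "AE x in lborel. ennreal (indicator {0<..<a} x / measure lborel {0<..<a}) =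
      ennreal (indicator {0..a} x / measure lborel {0..a})"
    by eventually_elim (use a in \<open>auto split: split_indicator\<close>)
  then have "distributed M lborel X (\<lambda>x. indicator {0..a} x / measure lborel {0..a})"
    using D by (subst (asm) distributed_cong_density) auto
  then have "\<P>(x in M. X x \<le> t) = t / a"
    using t uniform_distributed_measure[of X 0 a t] by simp
  moreover have [measurable]: "X \<in> borel_measurable M"
    using distributed_measurable[OF D] by simp
  have "{x \<in> space M. t < X x} = space M - {x \<in> space M. X x \<le> t}"
    by auto
  then have "\<P>(x in M. t < X x) = 1 - \<P>(x in M. X x \<le> t)"
    by (simp add: prob_compl)
  ultimately show ?thesis
    by simp
qed

lemma prob_min_uniform_exponential_le:
  fixes a l :: real
  assumes a: "0 < a" and l: "0 < l"
    and U: "distributed M lborel X (\<lambda>x. ennreal (indicator {0<..<a} x / measure lborel {0<..<a}))"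
    and E: "distributed M lborel Y (\<lambda>x. ennreal (exponential_density l x))"
    and I: "indep_var borel X borel Y"
  shows "\<P>(\<omega> in M. min (X \<omega>) (Y \<omega>) \<le> x) = min_U_Exp_cdf a l x"
proof -
  have [measurable]: "X \<in> borel_measurable M" "Y \<in> borel_measurable M"
    using distributed_measurable[OF U] distributed_measurable[OF E] by simp_all
  let ?L = "\<lambda>x. \<P>(\<omega> in M. min (X \<omega>) (Y \<omega>) \<le> x)"
  have eq: "?L x = min_U_Exp_cdf a l x" if x: "0 \<le> x" "x \<le> a" for x
  proof -
    \<comment> \<open>The minimum exceeds x exactly when both variables do, so the complement is the
      preimage of a rectangle and its probability factorises.\<close>
    have "{\<omega> \<in> space M. min (X \<omega>) (Y \<omega>) \<le> x} =
        space M - (\<lambda>\<omega>. (X \<omega>, Y \<omega>)) -` ({x<..} \<times> {x<..}) \<inter> space M"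
      by (auto simp: min_le_iff_disj)
    moreover have "(\<lambda>\<omega>. (X \<omega>, Y \<omega>)) -` ({x<..} \<times> {x<..}) \<inter> space M \<in> events"
      by measurable
    ultimately have "?L x = 1 - prob ((\<lambda>\<omega>. (X \<omega>, Y \<omega>)) -` ({x<..} \<times> {x<..}) \<inter> space M)"
      using prob_compl by (simp add: Diff_Int_distrib)
    also have "\<dots> = 1 - prob (X -` {x<..} \<inter> space M) * prob (Y -` {x<..} \<inter> space M)"
      by (subst indep_varD[OF I]) auto
    also have "X -` {x<..} \<inter> space M = {\<omega> \<in> space M. x < X \<omega>}"
      by auto
    also have "prob {\<omega> \<in> space M. x < X \<omega>} = 1 - x / a"
      by (rule uniform_open_distributed_gt[OF a U x])
    also have "Y -` {x<..} \<inter> space M = {\<omega> \<in> space M. x < Y \<omega>}"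
      by auto
    also have "prob {\<omega> \<in> space M. x < Y \<omega>} = exp (- x * l)"
      by (rule exponential_distributedD_gt[OF E x(1) l])
    also have "1 - (1 - x / a) * exp (- x * l) = min_U_Exp_cdf a l x"
      using x by (auto simp: min_U_Exp_cdf_def algebra_simps)
    finally show ?thesis .
  qed
  \<comment> \<open>Outside [0, a] monotonicity suffices: the formula just proved gives 0 at x = 0
    and 1 at x = a, and probabilities lie between 0 and 1.\<close>
  consider "x < 0" | "0 \<le> x" "x \<le> a" | "a < x"
    by linarith
  then show ?thesis
  proof cases
    case 1
    then have "?L x \<le> ?L 0"
      by (intro finite_measure_mono) auto
    moreover have "?L 0 = 0"
      using eq[of 0] a by (simp add: min_U_Exp_cdf_def)
    ultimately show ?thesis
      using 1 measure_nonneg[of M "{\<omega> \<in> space M. min (X \<omega>) (Y \<omega>) \<le> x}"]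
      by (simp add: min_U_Exp_cdf_def)
  next
    case 2
    then show ?thesis
      by (rule eq)
  next
    case 3
    then have "?L a \<le> ?L x"
      by (intro finite_measure_mono) auto
    moreover have "?L a = 1"
      using eq[of a] a by (simp add: min_U_Exp_cdf_def)
    ultimately show ?thesis
      using 3 a prob_le_1[of "{\<omega> \<in> space M. min (X \<omega>) (Y \<omega>) \<le> x}"]
      by (simp add: min_U_Exp_cdf_def)
  qed
qed

text \<open>Half-lines generate the Borel sets, so it is enough that the distribution function
  equals the integral of the density over each \<open>{..x}\<close>.\<close>

lemma distributed_min_uniform_exponential:
  fixes a l :: real
  assumes "0 < a" "0 < l"
    and U: "distributed M lborel X (\<lambda>x. ennreal (indicator {0<..<a} x / measure lborel {0<..<a}))"
    and E: "distributed M lborel Y (\<lambda>x. ennreal (exponential_density l x))"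
    and "indep_var borel X borel Y"
  shows "distributed M lborel (\<lambda>\<omega>. min (X \<omega>) (Y \<omega>)) (min_U_Exp_density a l)"
proof (rule distributedI_borel_atMost)
  have [measurable]: "X \<in> borel_measurable M" "Y \<in> borel_measurable M"
    using distributed_measurable[OF U] distributed_measurable[OF E] by simp_all
  show "(\<lambda>\<omega>. min (X \<omega>) (Y \<omega>)) \<in> borel_measurable M"
    by measurable
  show "emeasure M {\<omega> \<in> space M. min (X \<omega>) (Y \<omega>) \<le> x} = ennreal (min_U_Exp_cdf a l x)" for x
    using prob_min_uniform_exponential_le[OF assms] by (simp add: emeasure_eq_measure)
qed (use assms in \<open>auto intro: nn_integral_min_U_Exp_density min_U_Exp_density_nonneg\<close>)

end

section \<open>Expectations evaluated through antiderivatives\<close>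

lemma min_U_Exp_expectation_FTC:
  fixes g G :: "real \<Rightarrow> real"
  assumes "0 < a" "0 < l" and D: "distributed M lborel X (min_U_Exp_density a l)"
    and g: "continuous_on UNIV g"
    and G: "\<And>x. x \<in> {0..a} \<Longrightarrow> (G has_real_derivative
              g x * ((l + 1 / a - l * x / a) * exp (- l * x))) (at x within {0..a})"
  shows "integrable M (\<lambda>\<omega>. g (X \<omega>))" "(\<integral>\<omega>. g (X \<omega>) \<partial>M) = G a - G 0"
proof -
  \<comment> \<open>The Bochner form yields integrability together with the value. Derivatives
    relative to \<open>{0..a}\<close> suffice, which admits antiderivatives built from the
    incomplete gamma function.\<close>
  have "has_bochner_integral lborel
      (\<lambda>x. indicator {0..a} x *\<^sub>R (g x * ((l + 1 / a - l * x / a) * exp (- l * x)))) (G a - G 0)"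
    using assms
    by (intro has_bochner_integral_FTC_Icc)
       (auto simp flip: has_real_derivative_iff_has_vector_derivative
             intro!: continuous_intros intro: continuous_on_subset)
  then have "has_bochner_integral lborel (\<lambda>x. min_U_Exp_density a l x * g x) (G a - G 0)"
    by (simp add: min_U_Exp_density_def mult_ac)
  moreover have "g \<in> borel_measurable lborel"
    using g by (simp add: borel_measurable_continuous_onI)
  ultimately show "integrable M (\<lambda>\<omega>. g (X \<omega>))" "(\<integral>\<omega>. g (X \<omega>) \<partial>M) = G a - G 0"
    using distributed_integrable[OF D, of g] distributed_integral[OF D, of g]
      min_U_Exp_density_nonneg[OF assms(1,2)]
    by (auto simp: has_bochner_integral_iff)
qed

text \<open>With T(x) = (1 - x/a) exp(-l x) the tail, integration by parts turns the k-th moment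
  into the integral of k x^(k-1) T(x) over [0, a]. Substituting u = l x splits this into the two
  incomplete gamma terms.\<close>

lemma min_U_Exp_moment:
  fixes k :: nat
  assumes "0 < a" "0 < l" and D: "distributed M lborel X (min_U_Exp_density a l)" and "1 \<le> k"
  shows "integrable M (\<lambda>\<omega>. X \<omega> ^ k)" (is ?int)
    and "(\<integral>\<omega>. X \<omega> ^ k \<partial>M) = real k / l ^ k *
           (lower_incomplete_gamma (real k) (a * l)
            - lower_incomplete_gamma (real (k + 1)) (a * l) / (a * l))" (is ?eq)
proof -
  obtain n where k: "k = Suc n"
    using \<open>1 \<le> k\<close> by (cases k) auto
  let ?\<gamma> = "\<lambda>n x. lower_incomplete_gamma (real (Suc n)) (l * x)"
  \<comment> \<open>Here \<open>?\<gamma> n\<close> has first argument n + 1 = k. The first summand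
    has derivative k x^n T(x), and the subtracted x^k T(x) has derivative k x^n T(x) minus x^k times
    the density, so x^k times the density is left.\<close>
  let ?G = "\<lambda>x. real k / l ^ k * (?\<gamma> n x - ?\<gamma> k x / (a * l)) - x ^ k * ((1 - x / a) * exp (- l * x))"
  have "(?G has_real_derivative x ^ k * ((l + 1 / a - l * x / a) * exp (- l * x))) (at x within {0..a})"
    if "x \<in> {0..a}" for x
  proof -
    let ?E = "exp (- (l * x))"
    have "((\<lambda>x. real k / l ^ k * (?\<gamma> n x - ?\<gamma> k x / (a * l))) has_real_derivative
        real k / l ^ k * (l * ((l * x) ^ n * ?E) - l * ((l * x) ^ k * ?E) / (a * l)))
        (at x within {0..a})"
      by (intro DERIV_cmult DERIV_diff DERIV_cdivide that
          has_real_derivative_lower_incomplete_gamma_scaled[OF \<open>0 < l\<close>])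
    also have "real k / l ^ k * (l * ((l * x) ^ n * ?E) - l * ((l * x) ^ k * ?E) / (a * l)) =
        real k * x ^ n * ((1 - x / a) * ?E)"
      using assms(1,2) by (simp add: k power_mult_distrib field_simps del: of_nat_Suc)
    finally have "((\<lambda>x. real k / l ^ k * (?\<gamma> n x - ?\<gamma> k x / (a * l))) has_real_derivative
        real k * x ^ n * ((1 - x / a) * ?E)) (at x within {0..a})" .
    moreover have "((\<lambda>x. x ^ k * ((1 - x / a) * exp (- l * x))) has_real_derivative
        real k * x ^ n * ((1 - x / a) * ?E) - x ^ k * ((l + 1 / a - l * x / a) * ?E))
        (at x within {0..a})"
      using assms(1)
      by - ((rule derivative_eq_intros refl | simp)+, simp add: k field_simps del: of_nat_Suc)
    ultimately show ?thesis
      by (auto dest: DERIV_diff)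
  qed
  note FTC = min_U_Exp_expectation_FTC[OF assms(1-3) _ this]
  show ?int
    by (rule FTC) (auto intro!: continuous_intros)
  have "(\<integral>\<omega>. X \<omega> ^ k \<partial>M) = ?G a - ?G 0"
    by (rule FTC) (auto intro!: continuous_intros)
  \<comment> \<open>The boundary term x^k T(x) vanishes at a because T(a) = 0, and at 0 because k is
    positive.\<close>
  then show ?eq
    using assms by (simp add: k lower_incomplete_gamma_0_right mult.commute[of l a])
qed

text \<open>The weight exp(-t x) only changes the rate in the exponential from l to s = l + t; the
  factor in front stays affine, so an affine function times exp(-s x) can serve as
  antiderivative.\<close>

lemma min_U_Exp_Laplace:
  assumes "0 < a" "0 < l" and D: "distributed M lborel X (min_U_Exp_density a l)" and "0 \<le> t"
  shows "integrable M (\<lambda>\<omega>. exp (- X \<omega> * t))" (is ?int)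
    and "(\<integral>\<omega>. exp (- X \<omega> * t) \<partial>M) =
           l / (l + t) + t / (a * (l + t)\<^sup>2) * (1 - exp (- (l + t) * a))" (is ?eq)
proof -
  define s where "s = l + t"
  have s: "0 < s" "t = s - l"
    using assms by (simp_all add: s_def)
  \<comment> \<open>Matching coefficients in B - s (A + B x) = l + 1/a - l x/a: the x-term fixes B,
    then the constant term fixes A.\<close>
  define B where "B = l / (a * s)"
  define A where "A = (B - l - 1 / a) / s"
  let ?G = "\<lambda>x. (A + B * x) * exp (- s * x)"
  have "(?G has_real_derivative exp (- x * t) * ((l + 1 / a - l * x / a) * exp (- l * x)))
          (at x within {0..a})" for x
  proof -
    have "exp (- x * t) * exp (- l * x) = exp (- s * x)"
      by (simp add: s_def algebra_simps flip: exp_add)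
    moreover have "B - s * (A + B * x) = l + 1 / a - l * x / a"
      using s assms by (simp add: A_def B_def field_simps)
    ultimately have *: "exp (- x * t) * ((l + 1 / a - l * x / a) * exp (- l * x)) =
        (B - s * (A + B * x)) * exp (- s * x)"
      by (metis mult.assoc mult.commute)
    show ?thesis
      unfolding * by (auto intro!: derivative_eq_intros simp: algebra_simps)
  qed
  note FTC = min_U_Exp_expectation_FTC[OF assms(1-3) _ this]
  show ?int
    by (rule FTC) (auto intro!: continuous_intros)
  have "(\<integral>\<omega>. exp (- X \<omega> * t) \<partial>M) = ?G a - ?G 0"
    by (rule FTC) (auto intro!: continuous_intros)
  also have "\<dots> = (A + B * a) * exp (- s * a) - A"
    by simp
  \<comment> \<open>Both boundary coefficients contain -t/(a s^2), which becomes the common factor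
    of 1 - exp(-s a); the remaining part of -A is l/s.\<close>
  also have "A + B * a = - (t / (a * s\<^sup>2))"
    using s(1) assms(1) by (simp add: A_def B_def s(2) field_simps power2_eq_square)
  also have "A = - (l / s + t / (a * s\<^sup>2))"
    using s(1) assms(1) by (simp add: A_def B_def s(2) field_simps power2_eq_square)
  finally show ?eq
    by (simp add: s_def algebra_simps diff_divide_distrib)
qed

section \<open>The five claims, with mean and variance made explicit\<close>

theorem theorem1:
  fixes M :: "'a measure" and a l :: real and u e \<xi> :: "'a \<Rightarrow> real"
  assumes "prob_space M"
    and "a > 0" and "l > 0"
    and "distributed M lborel u (\<lambda>x. ennreal (indicator {0<..<a} x / measure lborel {0<..<a}))"
    and "distributed M lborel e (\<lambda>x. ennreal (exponential_density l x))"
    and "prob_space.indep_var M borel u borel e"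
    and "\<xi> = (\<lambda>\<omega>. min (u \<omega>) (e \<omega>))"
  shows
    "min_U_Exp_distributed M \<xi> a l
     \<and> (integrable M \<xi>
        \<and> prob_space.expectation M \<xi> = 1 / (a * l\<^sup>2) * (a * l - 1 + exp (- l * a)))
     \<and> (\<forall>k::nat. k \<ge> 1 \<longrightarrow>
          integrable M (\<lambda>\<omega>. \<xi> \<omega> ^ k)
          \<and> prob_space.expectation M (\<lambda>\<omega>. \<xi> \<omega> ^ k) =
            real k / l ^ k *
              (lower_incomplete_gamma (real k) (a * l)
               - lower_incomplete_gamma (real (k + 1)) (a * l) / (a * l)))
     \<and> prob_space.variance M \<xi> =
         1 / l\<^sup>2 * (2 + 2 * exp (- l * a)
                 - 1 / (a\<^sup>2 * l\<^sup>2) * (a * l + 1 - exp (- l * a))\<^sup>2)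
     \<and> (\<forall>t::real. t \<ge> 0 \<longrightarrow>
          integrable M (\<lambda>\<omega>. exp (- \<xi> \<omega> * t))
          \<and> prob_space.expectation M (\<lambda>\<omega>. exp (- \<xi> \<omega> * t)) =
            l / (l + t) + t / (a * (l + t)\<^sup>2) * (1 - exp (- (l + t) * a)))"
proof -
  interpret prob_space M by fact
  have D: "distributed M lborel \<xi> (min_U_Exp_density a l)"
    using distributed_min_uniform_exponential[OF assms(2-6)] assms(7) by simp
  then have [measurable]: "\<xi> \<in> borel_measurable M"
    using distributed_measurable by fastforce
  have "cdf (distr M borel \<xi>) x = min_U_Exp_cdf a l x" for x
  proof -
    have "cdf (distr M borel \<xi>) x = prob (\<xi> -` {..x} \<inter> space M)"
      by (simp add: cdf_def measure_distr)
    also have "\<xi> -` {..x} \<inter> space M = {\<omega> \<in> space M. min (u \<omega>) (e \<omega>) \<le> x}"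
      using assms(7) by auto
    finally show ?thesis
      using prob_min_uniform_exponential_le[OF assms(2-6)] by simp
  qed
  then have cdf: "min_U_Exp_distributed M \<xi> a l"
    using assms(2,3) by (simp add: min_U_Exp_distributed_def)

  note moment = min_U_Exp_moment[OF assms(2,3) D]
  define b where "b = a * l"
  have b: "0 < b"
    using assms(2,3) by (simp add: b_def)
  \<comment> \<open>The first moment involves the gamma values at 1 and 2, the second those at 2 and
    3; the recursion produces all three from the first.\<close>
  have \<gamma>1: "lower_incomplete_gamma 1 b = 1 - exp (- b)"
    using b by (simp add: lower_incomplete_gamma_1)
  have \<gamma>2: "lower_incomplete_gamma 2 b = 1 - exp (- b) - b * exp (- b)"
    using lower_incomplete_gamma_rec[of b 0] b by (simp add: \<gamma>1)
  have \<gamma>3: "lower_incomplete_gamma 3 b = 2 * (1 - exp (- b) - b * exp (- b)) - b\<^sup>2 * exp (- b)"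
    using lower_incomplete_gamma_rec[of b 1] b by (simp add: \<gamma>2 power2_eq_square)

  have int1: "integrable M \<xi>"
    using moment(1)[of 1] by simp
  have mean_b: "expectation \<xi> = (b - 1 + exp (- b)) / (l * b)"
    using moment(2)[of 1] b assms(3) by (simp add: \<gamma>1 \<gamma>2 field_simps flip: b_def)
  then have mean: "expectation \<xi> = 1 / (a * l\<^sup>2) * (a * l - 1 + exp (- l * a))"
    by (simp add: b_def power2_eq_square mult_ac)

  have "expectation (\<lambda>\<omega>. (\<xi> \<omega>)\<^sup>2) = 2 / l\<^sup>2 * (1 + exp (- b) - 2 / b + 2 * exp (- b) / b)"
    using moment(2)[of 2] b assms(3)
    by (simp add: \<gamma>2 \<gamma>3 field_simps power2_eq_square flip: b_def)
  then have "variance \<xi> = 2 / l\<^sup>2 * (1 + exp (- b) - 2 / b + 2 * exp (- b) / b)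
      - ((b - 1 + exp (- b)) / (l * b))\<^sup>2"
    using variance_eq[OF int1] moment(1)[of 2] by (simp flip: mean_b)
  \<comment> \<open>With q = 1 - exp(-b), the terms over b^2 combine by completing the square: (b -
    q)^2 + 4 b q = (b + q)^2.\<close>
  also have "\<dots> = 1 / l\<^sup>2 * (2 + 2 * exp (- b) - 1 / b\<^sup>2 * (b + 1 - exp (- b))\<^sup>2)"
    using b assms(3) by (simp add: field_simps power2_eq_square)
  finally have var: "variance \<xi> = 1 / l\<^sup>2 * (2 + 2 * exp (- l * a)
      - 1 / (a\<^sup>2 * l\<^sup>2) * (a * l + 1 - exp (- l * a))\<^sup>2)"
    by (simp add: b_def power_mult_distrib mult.commute[of l a])

  show ?thesis
    using cdf int1 mean moment var min_U_Exp_Laplace[OF assms(2,3) D] by blast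
qed

end
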